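(* Let $n\ge1$, let $\mathcal{L}\subset\mathbb{R}^{n+1}$ be an $(n+1)$-dimensional lattice with holohedry $H_{\mathcal{L}}$, let $y_0>0$, let $\widetilde{J}=\Pi_{y_0}(H_{\mathcal{L}})$, and let $k\in\mathcal{L}^*$. Then there are $\delta_j\in H_{\mathcal{L}}$, $j=2,\ldots,r$, yielding $k_1=k,\ k_2=\delta_2k,\ \ldots,\ k_r=\delta_rk$ such that $H_{\mathcal{L}}\cdot k$ is the disjoint union $$H_{\mathcal{L}}\cdot k=(S_{k_1}\cdot k_1)\cup(S_{k_2}\cdot k_2)\cup\cdots\cup(S_{k_r}\cdot k_r),$$ and therefore the projection $P(H_{\mathcal{L}}\cdot k)$ is a disjoint union of $\widetilde{J}$-orbits.
   Context: An $(n+1)$-dimensional lattice in $\mathbb{R}^{n+1}$ is the set of integer combinations of $n+1$ linearly independent vectors. Points of $\mathbb{R}^{n+1}$ are written $(x,y)$ with $x\in\mathbb{R}^n$, $y\in\mathbb{R}$, and $P:\mathbb{R}^{n+1}\to\mathbb{R}^n$ is $P(x,y)=x$. The dual lattice is $\mathcal{L}^*=\{k\in\mathbb{R}^{n+1}:\ \langle k,l\rangle\in\mathbb{Z}\text{ for all }l\in\mathcal{L}\}$. The holohedry of $\mathcal{L}$ is the finite group $H_{\mathcal{L}}=\{\gamma\in O(n+1):\gamma\mathcal{L}=\mathcal{L}\}$; it acts on $\mathcal{L}^*$. For $\alpha\in O(n)$ let $\alpha_+=\begin{pmatrix}\alpha&0\\0&1\end{pmatrix}$ and $\alpha_-=\begin{pmatrix}\alpha&0\\0&-1\end{pmatrix}$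 in $O(n+1)$. The group $\widetilde{J}=\Pi_{y_0}(H_{\mathcal{L}})\subset O(n)$ of induced orthogonal symmetries consists of those $\alpha\in O(n)$ such that either $\alpha_+\in H_{\mathcal{L}}$, or both $(0,y_0)\in\mathcal{L}$ and $\alpha_-\in H_{\mathcal{L}}$. For $k=(\tilde{k},z)\in\mathcal{L}^*$ and $\alpha\in\widetilde{J}$, let $J_k^\alpha=\{\delta\in H_{\mathcal{L}}:\ P(\delta k)=\alpha\tilde{k}\}$ and $S_k=\bigcup_{\alpha\in\widetilde{J}}J_k^\alpha$. For a subset $A\subset H_{\mathcal{L}}$, $A\cdot k=\{\delta k:\delta\in A\}$. A $\widetilde{J}$-orbit is a set $\widetilde{J}\cdot u=\{\alpha u:\alpha\in\widetilde{J}\}$, $u\in\mathbb{R}^n$. *)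

theory Defs
  imports "HOL-Analysis.Analysis"
begin

text \<open>
  The space \<open>\<real>\<^sup>n\<^sup>+\<^sup>1\<close> is the Euclidean product space \<open>(real^'n) \<times> real\<close>, with \<open>n = CARD('n)\<close>, so a point
  is literally a pair \<open>(x, y)\<close> and the projection \<open>P\<close> is \<open>fst\<close>. Elements of \<open>O(n)\<close> and \<open>O(n+1)\<close>
  are orthogonal linear maps rather than matrices.
\<close>

definition is_full_lattice :: "'a::euclidean_space set \<Rightarrow> bool" where
  "is_full_lattice L \<longleftrightarrow>
     (\<exists>B. independent B \<and> card B = DIM('a) \<and>
          L = {(\<Sum>b\<in>B. real_of_int (c b) *\<^sub>R b) | c. True})"

definition dual_lattice :: "'a::euclidean_space set \<Rightarrow> 'a set" where
  "dual_lattice L = {k. \<forall>l\<in>L. k \<bullet> l \<in> \<int>}"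

definition holohedry :: "'a::euclidean_space set \<Rightarrow> ('a \<Rightarrow> 'a) set" where
  "holohedry L = {\<gamma>. orthogonal_transformation \<gamma> \<and> \<gamma> ` L = L}"

definition extend_plus :: "('a \<Rightarrow> 'a) \<Rightarrow> 'a \<times> real \<Rightarrow> 'a \<times> real" where
  "extend_plus \<alpha> = (\<lambda>(x, y). (\<alpha> x, y))"

definition extend_minus :: "('a \<Rightarrow> 'a) \<Rightarrow> 'a \<times> real \<Rightarrow> 'a \<times> real" where
  "extend_minus \<alpha> = (\<lambda>(x, y). (\<alpha> x, - y))"

definition induced_symmetries ::
    "real \<Rightarrow> ((real^'n) \<times> real) set \<Rightarrow> (real^'n \<Rightarrow> real^'n) set" where
  "induced_symmetries y0 L =
     {\<alpha>. orthogonal_transformation \<alpha> \<and>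
          (extend_plus \<alpha> \<in> holohedry L \<or>
           (0, y0) \<in> L \<and> extend_minus \<alpha> \<in> holohedry L)}"

text \<open>The set \<open>A \<cdot> u\<close>, for \<open>A\<close> any set of maps (not necessarily a group).\<close>

definition orbit_of :: "('a \<Rightarrow> 'a) set \<Rightarrow> 'a \<Rightarrow> 'a set" where
  "orbit_of A u = (\<lambda>\<delta>. \<delta> u) ` A"

definition J_set ::
    "((real^'n) \<times> real) set \<Rightarrow> (real^'n) \<times> real \<Rightarrow> (real^'n \<Rightarrow> real^'n)
      \<Rightarrow> ((real^'n) \<times> real \<Rightarrow> (real^'n) \<times> real) set" where
  "J_set L k \<alpha> = {\<delta> \<in> holohedry L. fst (\<delta> k) = \<alpha> (fst k)}"

definition S_set ::
    "real \<Rightarrow> ((real^'n) \<times> real) set \<Rightarrow> (real^'n) \<times> real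
      \<Rightarrow> ((real^'n) \<times> real \<Rightarrow> (real^'n) \<times> real) set" where
  "S_set y0 L k = (\<Union>\<alpha>\<in>induced_symmetries y0 L. J_set L k \<alpha>)"

end

theory Submission
  imports Defs
begin

text \<open>
  Membership in \<open>S_set y0 L \<kappa> \<cdot> \<kappa>\<close> only depends on the projection: it consists of the points of the
  holohedry orbit of \<open>\<kappa>\<close> that project into the orbit of \<open>fst \<kappa>\<close> under the induced symmetries. As the
  latter form a group, these pieces are the classes of an equivalence relation on the holohedry
  orbit of \<open>k\<close>. That orbit is finite because each of its points is determined by its inner
  products with a lattice basis, which are integers bounded by norms.
\<close>

section \<open>Groups of maps and their orbits\<close>

definition is_group_of_maps :: "('a \<Rightarrow> 'a) set \<Rightarrow> bool" where
  "is_group_of_maps G \<longleftrightarrow>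
     id \<in> G \<and> (\<forall>f\<in>G. \<forall>g\<in>G. f \<circ> g \<in> G) \<and> (\<forall>f\<in>G. \<exists>g\<in>G. g \<circ> f = id)"

lemma orbit_of_refl: "is_group_of_maps G \<Longrightarrow> u \<in> orbit_of G u"
  unfolding is_group_of_maps_def orbit_of_def by (metis id_apply image_eqI)

lemma orbit_of_subset:
  assumes "is_group_of_maps G" and "v \<in> orbit_of G u"
  shows "orbit_of G v \<subseteq> orbit_of G u"
proof -
  from assms(2) obtain f where f: "f \<in> G" "v = f u"
    unfolding orbit_of_def by blast
  have "g v \<in> orbit_of G u" if "g \<in> G" for g
  proof -
    have "g \<circ> f \<in> G"
      using assms(1) f(1) that unfolding is_group_of_maps_def by blast
    then show ?thesis
      using f(2) unfolding orbit_of_def by (metis comp_apply image_eqI)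
  qed
  then show ?thesis
    unfolding orbit_of_def by blast
qed

text \<open>The left inverse provided by \<open>is_group_of_maps\<close> carries \<open>f u\<close>
  back to \<open>u\<close>. It is automatically two-sided, since it has a left inverse in
  \<open>G\<close> as well.\<close>

lemma orbit_of_sym:
  assumes "is_group_of_maps G" and "v \<in> orbit_of G u"
  shows "u \<in> orbit_of G v"
proof -
  from assms(2) obtain f where f: "f \<in> G" "v = f u"
    unfolding orbit_of_def by blast
  then obtain g where "g \<in> G" "g \<circ> f = id"
    using assms(1) unfolding is_group_of_maps_def by blast
  then show ?thesis
    using f(2) unfolding orbit_of_def by (metis comp_apply id_apply image_eqI)
qed

text \<open>Orbits are equivalence classes; in particular, two orbits with a common point
  coincide.\<close>

lemma orbit_of_eq_iff:
  assumes "is_group_of_maps G"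
  shows "orbit_of G v = orbit_of G u \<longleftrightarrow> v \<in> orbit_of G u"
  by (metis assms orbit_of_refl orbit_of_subset orbit_of_sym subset_antisym)

section \<open>The holohedry and the induced symmetries as groups\<close>

lemma is_group_of_maps_holohedry: "is_group_of_maps (holohedry L)"
proof -
  have "inv f \<in> holohedry L \<and> inv f \<circ> f = id" if "f \<in> holohedry L" for f
  proof -
    have f: "orthogonal_transformation f" "f ` L = L"
      using that unfolding holohedry_def by auto
    then have "inj f"
      by (simp add: orthogonal_transformation_inj)
    then have "inv f \<circ> f = id" by simp
    moreover from this f(2) have "inv f ` L = L"
      by (metis image_comp image_id id_apply)
    ultimately show ?thesis
      using f(1) orthogonal_transformation_inv unfolding holohedry_def by blast
  qed
  moreover have "f \<circ> g \<in> holohedry L" if "f \<in> holohedry L" "g \<in> holohedry L" for f g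
  proof -
    have "(f \<circ> g) ` L = L"
      using that unfolding holohedry_def image_comp [symmetric] by simp
    then show ?thesis
      using that orthogonal_transformation_compose unfolding holohedry_def by blast
  qed
  moreover have "id \<in> holohedry L"
    using orthogonal_transformation_id by (simp add: holohedry_def flip: id_def)
  ultimately show ?thesis
    unfolding is_group_of_maps_def by blast
qed

text \<open>The signs on the last coordinate multiply, so products of extensions are again
  extensions.\<close>

lemma extend_comp:
  "extend_plus \<alpha> \<circ> extend_plus \<beta> = extend_plus (\<alpha> \<circ> \<beta>)"
  "extend_plus \<alpha> \<circ> extend_minus \<beta> = extend_minus (\<alpha> \<circ> \<beta>)"
  "extend_minus \<alpha> \<circ> extend_plus \<beta> = extend_minus (\<alpha> \<circ> \<beta>)"
  "extend_minus \<alpha> \<circ> extend_minus \<beta> = extend_plus (\<alpha> \<circ> \<beta>)"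
  by (auto simp: extend_plus_def extend_minus_def fun_eq_iff)

lemma extend_plus_id: "extend_plus id = id"
  by (auto simp: extend_plus_def)

lemma is_group_of_maps_induced_symmetries:
  fixes L :: "((real^'n) \<times> real) set"
  shows "is_group_of_maps (induced_symmetries y0 L)"
proof -
  note H = is_group_of_maps_holohedry [of L, unfolded is_group_of_maps_def]
  have "f \<circ> g \<in> induced_symmetries y0 L"
    if "f \<in> induced_symmetries y0 L" "g \<in> induced_symmetries y0 L" for f g
  proof -
    have "\<phi> \<circ> \<psi> \<in> holohedry L" if "\<phi> \<in> holohedry L" "\<psi> \<in> holohedry L" for \<phi> \<psi>
      using H that by blast
    \<comment> \<open>One instance per combination of signs. A product has sign minus only if
      exactly one factor does, and that factor supplies \<open>(0, y0) \<in> L\<close>.\<close>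
    note this [of "extend_plus f" "extend_plus g"] this [of "extend_plus f" "extend_minus g"]
      this [of "extend_minus f" "extend_plus g"] this [of "extend_minus f" "extend_minus g"]
    then show ?thesis
      using that orthogonal_transformation_compose [of f g]
      unfolding induced_symmetries_def by (auto simp: extend_comp)
  qed
  moreover have "inv f \<in> induced_symmetries y0 L \<and> inv f \<circ> f = id"
    if f: "f \<in> induced_symmetries y0 L" for f
  proof -
    have orth: "orthogonal_transformation f"
      using f unfolding induced_symmetries_def by auto
    then have inv: "inv f \<circ> f = id" "f \<circ> inv f = id"
      using orthogonal_transformation_inj [OF orth] orthogonal_transformation_surj [OF orth]
      by (simp_all add: surj_iff)
    have plus: "extend_plus (inv f) \<in> holohedry L" if "extend_plus f \<in> holohedry L"
    proof -
      obtain g where g: "g \<in> holohedry L" "g \<circ> extend_plus f = id"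
        using H \<open>extend_plus f \<in> holohedry L\<close> by blast
      \<comment> \<open>Uniqueness of inverses: the abstract inverse \<open>g\<close> must be the
        extension of \<open>inv f\<close>, which therefore lies in the holohedry.\<close>
      have "g = g \<circ> (extend_plus f \<circ> extend_plus (inv f))"
        unfolding extend_comp inv extend_plus_id by simp
      also have "\<dots> = extend_plus (inv f)"
        unfolding comp_assoc [symmetric] g(2) by simp
      finally show ?thesis using g(1) by simp
    qed
    have minus: "extend_minus (inv f) \<in> holohedry L" if "extend_minus f \<in> holohedry L"
    proof -
      obtain g where g: "g \<in> holohedry L" "g \<circ> extend_minus f = id"
        using H \<open>extend_minus f \<in> holohedry L\<close> by blast
      \<comment> \<open>The same argument with sign minus, where the two signs cancel in the
        product.\<close>
      have "g = g \<circ> (extend_minus f \<circ> extend_minus (inv f))"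
        unfolding extend_comp inv extend_plus_id by simp
      also have "\<dots> = extend_minus (inv f)"
        unfolding comp_assoc [symmetric] g(2) by simp
      finally show ?thesis using g(1) by simp
    qed
    show ?thesis
      using f plus minus inv(1) orthogonal_transformation_inv [OF orth]
      unfolding induced_symmetries_def by (auto simp: extend_comp)
  qed
  moreover have "id \<in> induced_symmetries y0 L"
    using H orthogonal_transformation_id
    by (simp add: induced_symmetries_def extend_plus_id flip: id_def)
  ultimately show ?thesis
    unfolding is_group_of_maps_def by blast
qed

section \<open>Finiteness of holohedry orbits\<close>

lemma dual_lattice_invariant:
  assumes "\<delta> \<in> holohedry L" and "k \<in> dual_lattice L"
  shows "\<delta> k \<in> dual_lattice L"
  unfolding dual_lattice_def
proof (intro CollectI ballI)
  fix l assume "l \<in> L"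
  \<comment> \<open>Pulling \<open>l\<close> back along \<delta> turns the product
    \<open>\<delta> k \<bullet> l\<close> into \<open>k \<bullet> m\<close>, because \<delta>
    preserves inner products.\<close>
  then obtain m where "m \<in> L" "l = \<delta> m"
    using assms(1) unfolding holohedry_def by blast
  then show "\<delta> k \<bullet> l \<in> \<int>"
    using assms unfolding holohedry_def dual_lattice_def orthogonal_transformation_def by simp
qed

lemma finite_dual_lattice_cball:
  assumes "is_full_lattice L"
  shows "finite {x \<in> dual_lattice L. norm x \<le> R}"
proof -
  obtain B where B: "independent B" "card B = DIM('a)"
      and L: "L = {(\<Sum>b\<in>B. real_of_int (c b) *\<^sub>R b) | c. True}"
    using assms unfolding is_full_lattice_def by blast
  have "finite B" using B(1) by (rule independent_imp_finite)
  have span: "span B = UNIV"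
    using card_ge_dim_independent [of B UNIV] B by (simp add: top.extremum_unique)
  have "B \<subseteq> L"
  proof
    fix b assume "b \<in> B"
    have "(\<Sum>a\<in>B. real_of_int (if a = b then 1 else 0) *\<^sub>R a) = (\<Sum>a\<in>B. if a = b then a else 0)"
      by (intro sum.cong) auto
    also have "\<dots> = b"
      using \<open>finite B\<close> \<open>b \<in> B\<close> by simp
    finally show "b \<in> L"
      unfolding L by (intro CollectI exI [of _ "\<lambda>a. if a = b then 1 else 0"]) simp
  qed
  let ?X = "{x \<in> dual_lattice L. norm x \<le> R}"
  \<comment> \<open>The coordinates against the basis, made extensional so that they lie in the
    finite product \<open>PiE\<close> of bounded integer sets.\<close>
  let ?\<phi> = "\<lambda>x. \<lambda>b\<in>B. x \<bullet> b"
  have "inj_on ?\<phi> ?X"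
  proof (rule inj_onI)
    fix x y assume "?\<phi> x = ?\<phi> y"
    then have "b \<bullet> (x - y) = 0" if "b \<in> B" for b
    proof -
      have "?\<phi> x b = ?\<phi> y b"
        by (simp only: \<open>?\<phi> x = ?\<phi> y\<close>)
      then show ?thesis
        using that by (simp add: inner_diff_right inner_commute [of b])
    qed
    \<comment> \<open>Orthogonality to \<open>B\<close> passes to its span, which is the whole space
      and so contains \<open>x - y\<close> itself.\<close>
    then have "orthogonal (x - y) (x - y)"
      using span orthogonal_to_span [of "x - y" B "x - y"]
      by (simp add: orthogonal_def inner_commute)
    then show "x = y" by (simp add: orthogonal_def)
  qed
  moreover have "finite (?\<phi> ` ?X)"
  proof (rule finite_subset)
    show "?\<phi> ` ?X \<subseteq> (\<Pi>\<^sub>E b\<in>B. {a \<in> \<int>. \<bar>a\<bar> \<le> R * norm b})"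
    proof
      fix f assume "f \<in> ?\<phi> ` ?X"
      then obtain x where x: "x \<in> dual_lattice L" "norm x \<le> R" and f: "f = ?\<phi> x"
        by blast
      have "x \<bullet> b \<in> {a \<in> \<int>. \<bar>a\<bar> \<le> R * norm b}" if b: "b \<in> B" for b
      proof -
        have "\<bar>x \<bullet> b\<bar> \<le> norm x * norm b"
          by (rule Cauchy_Schwarz_ineq2)
        also have "\<dots> \<le> R * norm b"
          using x(2) by (rule mult_right_mono) simp
        finally show ?thesis
          using x(1) b \<open>B \<subseteq> L\<close> unfolding dual_lattice_def by blast
      qed
      then show "f \<in> (\<Pi>\<^sub>E b\<in>B. {a \<in> \<int>. \<bar>a\<bar> \<le> R * norm b})"
        unfolding f by (rule restrict_PiE_iff [THEN iffD2, rule_format])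
    qed
    show "finite (\<Pi>\<^sub>E b\<in>B. {a::real \<in> \<int>. \<bar>a\<bar> \<le> R * norm b})"
      using \<open>finite B\<close> by (intro finite_PiE finite_abs_int_segment)
  qed
  ultimately show ?thesis by (simp only: finite_image_iff)
qed

text \<open>Orthogonal maps keep the norm and the holohedry keeps the dual lattice, so the orbit
  stays in a ball of that lattice.\<close>

lemma finite_holohedry_orbit:
  assumes "is_full_lattice L" and "k \<in> dual_lattice L"
  shows "finite (orbit_of (holohedry L) k)"
proof (rule finite_subset)
  show "orbit_of (holohedry L) k \<subseteq> {x \<in> dual_lattice L. norm x \<le> norm k}"
    using dual_lattice_invariant [OF _ assms(2)]
    by (auto simp: orbit_of_def holohedry_def orthogonal_transformation_norm)
qed (rule finite_dual_lattice_cball [OF assms(1)])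

section \<open>Pieces of an orbit, their projections and representatives\<close>

lemma orbit_of_S_set:
  "orbit_of (S_set y0 L k) k =
     {x \<in> orbit_of (holohedry L) k. fst x \<in> orbit_of (induced_symmetries y0 L) (fst k)}"
proof -
  have "S_set y0 L k = {\<delta> \<in> holohedry L. fst (\<delta> k) \<in> orbit_of (induced_symmetries y0 L) (fst k)}"
    unfolding S_set_def J_set_def orbit_of_def by blast
  then show ?thesis
    unfolding orbit_of_def [of "S_set y0 L k"] orbit_of_def [of "holohedry L"] by blast
qed

text \<open>Both extensions of \<alpha> act as \<alpha> on the first component, and at least one of
  them belongs to the holohedry.\<close>

lemma orbit_of_induced_symmetries_subset:
  "orbit_of (induced_symmetries y0 L) (fst x) \<subseteq> fst ` orbit_of (holohedry L) x"
proof
  fix u assume "u \<in> orbit_of (induced_symmetries y0 L) (fst x)"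
  then obtain \<alpha> where \<alpha>: "\<alpha> \<in> induced_symmetries y0 L" "u = \<alpha> (fst x)"
    unfolding orbit_of_def by blast
  have "fst (extend_plus \<alpha> x) = u" "fst (extend_minus \<alpha> x) = u"
    using \<alpha>(2) by (auto simp: extend_plus_def extend_minus_def split: prod.splits)
  then show "u \<in> fst ` orbit_of (holohedry L) x"
    using \<alpha>(1) unfolding orbit_of_def induced_symmetries_def mem_Collect_eq
    by (metis imageI)
qed

text \<open>Here \<open>c\<close> is a class map: one representative is chosen for each of its
  values on \<open>X\<close>, with \<open>k\<close> representing its own class and listed
  first.\<close>

lemma enumerate_class_representatives:
  assumes "finite X" and "k \<in> X"
  obtains r :: nat and \<kappa> where "r \<ge> 1" "\<kappa> 1 = k" "\<kappa> ` {1..r} \<subseteq> X"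
    "inj_on (c \<circ> \<kappa>) {1..r}" "c ` X = (c \<circ> \<kappa>) ` {1..r}"
proof -
  \<comment> \<open>The classes other than that of \<open>k\<close> are numbered from 1 to
    \<open>m\<close> and moved to the positions from 2 to \<open>Suc m\<close>, which frees position
    1 for \<open>k\<close>.\<close>
  define m where "m = card (c ` X - {c k})"
  obtain g where g: "bij_betw g {1..m} (c ` X - {c k})"
    using ex_bij_betw_nat_finite_1 [of "c ` X - {c k}"] assms(1) unfolding m_def by auto
  define \<kappa> where "\<kappa> j = (if j = 1 then k else inv_into X c (g (j - 1)))" for j
  have mem: "g (j - 1) \<in> c ` X - {c k}" if "j \<in> {2..Suc m}" for j
    using that by (intro bij_betwE [OF g, rule_format]) auto
  have c\<kappa>: "c (\<kappa> j) = g (j - 1)" if "j \<in> {2..Suc m}" for j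
    using mem [OF that] that by (simp add: \<kappa>_def f_inv_into_f)
  have range: "{1..Suc m} = insert 1 {2..Suc m}" by auto
  have shift: "(\<lambda>j. j - 1) ` {2..Suc m} = {1..m}"
    by (force intro: image_eqI [where x = "Suc _"])
  have "(c \<circ> \<kappa>) ` {2..Suc m} = g ` (\<lambda>j. j - 1) ` {2..Suc m}"
    unfolding image_image by (rule image_cong) (auto simp: c\<kappa>)
  then have im: "(c \<circ> \<kappa>) ` {2..Suc m} = c ` X - {c k}"
    using g by (simp only: shift bij_betw_def)
  have "inj_on (c \<circ> \<kappa>) {2..Suc m}"
  proof (rule inj_onI)
    fix i j assume ij: "i \<in> {2..Suc m}" "j \<in> {2..Suc m}" and "(c \<circ> \<kappa>) i = (c \<circ> \<kappa>) j"
    then have "g (i - 1) = g (j - 1)" by (simp add: c\<kappa>)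
    moreover have "i - 1 \<in> {1..m}" "j - 1 \<in> {1..m}" using ij by auto
    ultimately have "i - 1 = j - 1"
      using g unfolding bij_betw_def by (metis inj_onD)
    then show "i = j" using ij by auto
  qed
  moreover have c1: "c (\<kappa> 1) = c k" by (simp add: \<kappa>_def)
  \<comment> \<open>Position 1 adds no collision, since \<open>c k\<close> was removed from the
    values taken at the other positions.\<close>
  ultimately have "inj_on (c \<circ> \<kappa>) {1..Suc m}"
    unfolding range inj_on_insert using im by auto
  moreover have "c ` X = (c \<circ> \<kappa>) ` {1..Suc m}"
    unfolding range image_insert im using c1 assms(2) by auto
  moreover have "\<kappa> ` {1..Suc m} \<subseteq> X"
  proof -
    have "\<kappa> j \<in> X" if "j \<in> {2..Suc m}" for j
      using mem [OF that] that by (auto simp: \<kappa>_def intro: inv_into_into)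
    then show ?thesis unfolding range using assms(2) by (auto simp: \<kappa>_def)
  qed
  ultimately show thesis
    using that [of "Suc m" \<kappa>] by (simp add: \<kappa>_def)
qed

theorem theorem7:
  fixes L :: "((real^'n) \<times> real) set"
    and k :: "(real^'n) \<times> real"
    and y0 :: real
  assumes "is_full_lattice L"
    and "y0 > 0"
    and "k \<in> dual_lattice L"
  shows "\<exists>(r::nat) (\<delta> :: nat \<Rightarrow> (real^'n) \<times> real \<Rightarrow> (real^'n) \<times> real) (\<kappa> :: nat \<Rightarrow> (real^'n) \<times> real).
           r \<ge> 1 \<and>
           (\<forall>j\<in>{2..r}. \<delta> j \<in> holohedry L) \<and>
           \<kappa> 1 = k \<and> (\<forall>j\<in>{2..r}. \<kappa> j = \<delta> j k) \<and>
           orbit_of (holohedry L) k = (\<Union>j\<in>{1..r}. orbit_of (S_set y0 L (\<kappa> j)) (\<kappa> j)) \<and>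
           disjoint_family_on (\<lambda>j. orbit_of (S_set y0 L (\<kappa> j)) (\<kappa> j)) {1..r} \<and>
           fst ` orbit_of (holohedry L) k =
             (\<Union>j\<in>{1..r}. orbit_of (induced_symmetries y0 L) (fst (\<kappa> j))) \<and>
           disjoint_family_on (\<lambda>j. orbit_of (induced_symmetries y0 L) (fst (\<kappa> j))) {1..r}"
proof -
  define X where "X = orbit_of (holohedry L) k"
  \<comment> \<open>Two points of \<open>X\<close> belong to the same piece exactly when their
    values under \<open>c\<close> agree.\<close>
  define c where "c x = orbit_of (induced_symmetries y0 L) (fst x)" for x :: "(real^'n) \<times> real"
  note J = is_group_of_maps_induced_symmetries [of y0 L]
  note H = is_group_of_maps_holohedry [of L]
  have "finite X" "k \<in> X"
    using finite_holohedry_orbit assms orbit_of_refl [OF H] unfolding X_def by auto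
  then obtain r :: nat and \<kappa> where r: "r \<ge> 1" "\<kappa> 1 = k" and mem: "\<kappa> ` {1..r} \<subseteq> X"
      and inj: "inj_on (c \<circ> \<kappa>) {1..r}" and surj: "c ` X = (c \<circ> \<kappa>) ` {1..r}"
    by (rule enumerate_class_representatives [where c = c])
  \<comment> \<open>Every representative generates the same holohedry orbit, so all pieces are cut
    out of the one set \<open>X\<close>.\<close>
  have orbit: "orbit_of (holohedry L) (\<kappa> j) = X" if "j \<in> {1..r}" for j
    using mem that orbit_of_eq_iff [OF H] unfolding X_def by blast
  have S: "orbit_of (S_set y0 L (\<kappa> j)) (\<kappa> j) = {x \<in> X. fst x \<in> c (\<kappa> j)}" if "j \<in> {1..r}" for j
    unfolding orbit_of_S_set orbit [OF that] c_def ..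
  have cover: "\<exists>j\<in>{1..r}. fst x \<in> c (\<kappa> j)" if "x \<in> X" for x
  proof -
    have "fst x \<in> c x" unfolding c_def by (rule orbit_of_refl [OF J])
    moreover have "c x \<in> (c \<circ> \<kappa>) ` {1..r}"
      using that unfolding surj [symmetric] by (rule imageI)
    ultimately show ?thesis by auto
  qed
  \<comment> \<open>Induced orbits that meet are equal, whereas distinct indices have distinct
    values of \<open>c\<close>.\<close>
  have disj: "c (\<kappa> i) \<inter> c (\<kappa> j) = {}" if "i \<in> {1..r}" "j \<in> {1..r}" "i \<noteq> j" for i j
  proof (rule ccontr)
    assume "c (\<kappa> i) \<inter> c (\<kappa> j) \<noteq> {}"
    then have "c (\<kappa> i) = c (\<kappa> j)"
      unfolding c_def using orbit_of_eq_iff [OF J] by blast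
    then show False using inj_onD [OF inj, of i j] that by simp
  qed
  have "\<forall>j\<in>{1..r}. \<exists>d\<in>holohedry L. \<kappa> j = d k"
    using mem unfolding X_def orbit_of_def by blast
  then obtain \<delta> where \<delta>: "\<forall>j\<in>{1..r}. \<delta> j \<in> holohedry L \<and> \<kappa> j = \<delta> j k"
    by metis
  have "X = (\<Union>j\<in>{1..r}. orbit_of (S_set y0 L (\<kappa> j)) (\<kappa> j))"
    using cover by (auto simp: S)
  moreover have "disjoint_family_on (\<lambda>j. orbit_of (S_set y0 L (\<kappa> j)) (\<kappa> j)) {1..r}"
    unfolding disjoint_family_on_def
  proof (intro ballI impI)
    fix i j assume ij: "i \<in> {1..r}" "j \<in> {1..r}" "i \<noteq> j"
    \<comment> \<open>A common point would project into both of the disjoint induced orbits.\<close>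
    show "orbit_of (S_set y0 L (\<kappa> i)) (\<kappa> i) \<inter> orbit_of (S_set y0 L (\<kappa> j)) (\<kappa> j) = {}"
      unfolding S [OF ij(1)] S [OF ij(2)] using disj [OF ij] by blast
  qed
  moreover have "fst ` X = (\<Union>j\<in>{1..r}. c (\<kappa> j))"
  proof
    show "fst ` X \<subseteq> (\<Union>j\<in>{1..r}. c (\<kappa> j))" using cover by blast
    \<comment> \<open>Each induced orbit lifts to the holohedry orbit of its representative, which
      is \<open>X\<close>.\<close>
    show "(\<Union>j\<in>{1..r}. c (\<kappa> j)) \<subseteq> fst ` X"
      using orbit orbit_of_induced_symmetries_subset [of y0 L] unfolding c_def by blast
  qed
  moreover have "disjoint_family_on (\<lambda>j. c (\<kappa> j)) {1..r}"
    unfolding disjoint_family_on_def using disj by blast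
  ultimately show ?thesis
    using r \<delta> unfolding X_def c_def
    by (intro exI [of _ r] exI [of _ \<delta>] exI [of _ \<kappa>]) auto
qed

end
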